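(* Let $k$ be a positive integer. If $G$ is a simple connected $n$-vertex graph such that $\operatorname{edim}(G) = n-k$, then $G$ has diameter at most $3k-1$.
   Context: All graphs are simple and connected. For vertices $u,v$ of a graph $G$, $d(u,v)$ is their distance in $G$; the diameter is the maximum distance between two vertices. For an edge $e=\{x,y\}$ and a vertex $v$, let $d(e,v)=\min(d(x,v),d(y,v))$. A set $S\subset V(G)$ is a resolving set for the edges of $G$ if no two distinct edges $e,f$ satisfy $d(e,s)=d(f,s)$ for all $s\in S$. The edge metric dimension $\operatorname{edim}(G)$ is the minimum size of a resolving set for the edges of $G$. *)

theory Defs
  imports Main
begin

text \<open>A graph is given by its vertex set \<open>V\<close> and its set \<open>E\<close> of edges; an edge is a two-element
  set of vertices, which rules out loops and multiple edges.\<close>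

definition simple_graph :: "'a set \<Rightarrow> 'a set set \<Rightarrow> bool" where
  "simple_graph V E \<longleftrightarrow> finite V \<and> (\<forall>e\<in>E. e \<subseteq> V \<and> card e = 2)"

definition adj_rel :: "'a set set \<Rightarrow> ('a \<times> 'a) set" where
  "adj_rel E = {(u, v). {u, v} \<in> E}"

definition connected_graph :: "'a set \<Rightarrow> 'a set set \<Rightarrow> bool" where
  "connected_graph V E \<longleftrightarrow> V \<noteq> {} \<and> (\<forall>u\<in>V. \<forall>v\<in>V. (u, v) \<in> (adj_rel E)\<^sup>*)"

text \<open>The pair \<open>(u, v)\<close> lies in the \<open>m\<close>-th relational power of the adjacency relation iff there is a
  walk with \<open>m\<close> edges from \<open>u\<close> to \<open>v\<close>. The value is only meaningful if some walk
  exists, in particular for vertices of a connected graph.\<close>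

definition graph_dist :: "'a set set \<Rightarrow> 'a \<Rightarrow> 'a \<Rightarrow> nat" where
  "graph_dist E u v = (LEAST m. (u, v) \<in> adj_rel E ^^ m)"

definition diameter :: "'a set \<Rightarrow> 'a set set \<Rightarrow> nat" where
  "diameter V E = Max {graph_dist E u v | u v. u \<in> V \<and> v \<in> V}"

definition edge_dist :: "'a set set \<Rightarrow> 'a set \<Rightarrow> 'a \<Rightarrow> nat" where
  "edge_dist E e v = Min ((\<lambda>x. graph_dist E x v) ` e)"

lemma edge_dist_pair:
  "edge_dist E {x, y} v = min (graph_dist E x v) (graph_dist E y v)"
  by (simp add: edge_dist_def)

definition edge_resolving :: "'a set \<Rightarrow> 'a set set \<Rightarrow> 'a set \<Rightarrow> bool" where
  "edge_resolving V E S \<longleftrightarrow> S \<subseteq> V \<and>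
     \<not> (\<exists>e\<in>E. \<exists>f\<in>E. e \<noteq> f \<and> (\<forall>s\<in>S. edge_dist E e s = edge_dist E f s))"

definition edim :: "'a set \<Rightarrow> 'a set set \<Rightarrow> nat" where
  "edim V E = (LEAST m. \<exists>S. edge_resolving V E S \<and> card S = m)"

end

theory Submission
  imports Defs
begin

text \<open>A vertex \<open>s\<close> is at distance \<open>0\<close> from an edge exactly when it is an endpoint, so two edges
  that \<open>S\<close> fails to separate meet \<open>S\<close> in the same vertices. Suppose that the complement \<open>R\<close> of \<open>S\<close>
  consists of vertices pairwise at distance at least \<open>3\<close>. Then no edge lies inside \<open>R\<close>, so two
  distinct unseparated edges share their endpoint in \<open>S\<close> and their other endpoints are two vertices
  of \<open>R\<close> with a common neighbour, which is impossible. Hence \<open>V - R\<close> resolves the edges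
  (\<open>edge_resolving_Diff_packing\<close>) and \<open>edim V E \<le> card V - card R\<close>.

  A shortest path of length \<open>D\<close> supplies such a set \<open>R\<close>: every third of its vertices, which are
  \<open>D div 3 + 1\<close> many (\<open>geodesic\<close>). With \<open>D\<close> the diameter this gives
  \<open>edim V E + D div 3 < card V\<close> (\<open>edim_add_diameter_div_3_less\<close>), and \<open>edim V E = n - k\<close> forces
  \<open>D div 3 < k\<close>.\<close>

lemma graph_dist_le: "(u, v) \<in> adj_rel E ^^ m \<Longrightarrow> graph_dist E u v \<le> m"
  unfolding graph_dist_def by (rule Least_le)

lemma shortest_walk:
  assumes "(u, v) \<in> (adj_rel E)\<^sup>*"
  shows "(u, v) \<in> adj_rel E ^^ graph_dist E u v"
  using assms unfolding graph_dist_def rtrancl_power by (rule LeastI_ex)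

lemma graph_dist_self [simp]: "graph_dist E u u = 0"
  using graph_dist_le[of u u 0 E] by simp

lemma graph_dist_eq_0_iff:
  assumes "(u, v) \<in> (adj_rel E)\<^sup>*"
  shows "graph_dist E u v = 0 \<longleftrightarrow> u = v"
  using shortest_walk[OF assms] by auto

lemma graph_dist_commute: "graph_dist E u v = graph_dist E v u"
proof -
  have rev: "(v, u) \<in> adj_rel E ^^ m" if "(u, v) \<in> adj_rel E ^^ m" for u v m
    using that
  proof (induction m arbitrary: v)
    case (Suc m)
    then obtain w where "(u, w) \<in> adj_rel E ^^ m" "(w, v) \<in> adj_rel E"
      by auto
    then show ?case
      using Suc.IH by (intro relpow_Suc_I2[of v w]) (auto simp: adj_rel_def insert_commute)
  qed simp
  have "(u, v) \<in> adj_rel E ^^ m \<longleftrightarrow> (v, u) \<in> adj_rel E ^^ m" for m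
    using rev by blast
  then show ?thesis
    by (simp add: graph_dist_def)
qed

lemma graph_dist_edge: "{u, v} \<in> E \<Longrightarrow> graph_dist E u v \<le> 1"
  using graph_dist_le[of u v 1 E] by (simp add: adj_rel_def)

lemma graph_dist_common_neighbour:
  assumes "{u, x} \<in> E" "{x, v} \<in> E"
  shows "graph_dist E u v \<le> 2"
proof -
  have "(u, v) \<in> adj_rel E ^^ 2"
    using assms by (auto simp: adj_rel_def numeral_2_eq_2)
  then show ?thesis
    by (rule graph_dist_le)
qed

lemma simple_graph_edgeE:
  assumes "simple_graph V E" "e \<in> E"
  obtains x y where "e = {x, y}" "x \<noteq> y" "x \<in> V" "y \<in> V"
  using assms by (auto simp: simple_graph_def card_2_iff)

lemma edge_dist_eq_0_iff:
  assumes "simple_graph V E" "connected_graph V E" "e \<in> E" "s \<in> V"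
  shows "edge_dist E e s = 0 \<longleftrightarrow> s \<in> e"
proof -
  obtain x y where e: "e = {x, y}" "x \<in> V" "y \<in> V"
    using assms(1,3) by (rule simple_graph_edgeE)
  have "(x, s) \<in> (adj_rel E)\<^sup>*" "(y, s) \<in> (adj_rel E)\<^sup>*"
    using assms(2,4) e by (auto simp: connected_graph_def)
  then show ?thesis
    by (auto simp: e edge_dist_pair graph_dist_eq_0_iff min_def)
qed

text \<open>Landmarks at distance \<open>0\<close> suffice: edges with the same endpoints in \<open>V - R\<close> could differ only
  by two vertices of \<open>R\<close> with a common neighbour. The bound \<open>3\<close> excludes this, and also edges
  inside \<open>R\<close>, on which no landmark would lie.\<close>

lemma edge_resolving_Diff_packing:
  assumes G: "simple_graph V E" "connected_graph V E"
    and far: "\<And>a b. a \<in> R \<Longrightarrow> b \<in> R \<Longrightarrow> a \<noteq> b \<Longrightarrow> 3 \<le> graph_dist E a b"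
  shows "edge_resolving V E (V - R)"
proof -
  have inside: "x \<notin> R \<or> y \<notin> R" if "{x, y} \<in> E" "x \<noteq> y" for x y
    using far[of x y] graph_dist_edge[OF that(1)] that(2) by auto
  have split: "\<exists>x a. e = {x, a} \<and> x \<in> V - R \<and> a \<in> V" if "e \<in> E" for e
    using simple_graph_edgeE[OF G(1) that] that inside by (metis DiffI insert_commute)
  have "e = f" if ef: "e \<in> E" "f \<in> E"
    and same: "\<forall>s\<in>V - R. edge_dist E e s = edge_dist E f s" for e f
  proof (rule ccontr)
    assume "e \<noteq> f"
    have trace: "s \<in> e \<longleftrightarrow> s \<in> f" if "s \<in> V - R" for s
      using same that ef edge_dist_eq_0_iff[OF G] by (metis DiffD1)
    obtain x a where e: "e = {x, a}" and x: "x \<in> V - R" and a: "a \<in> V"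
      using split[OF ef(1)] by blast
    have "x \<in> f"
      using trace[OF x] e by simp
    then obtain b where f: "f = {x, b}" and "b \<in> V"
      using simple_graph_edgeE[OF G(1) ef(2)] by (metis insertE insert_commute singletonD)
    have "a \<noteq> b"
      using \<open>e \<noteq> f\<close> e f by blast
    moreover have "a \<noteq> x" "b \<noteq> x"
      using G(1) ef e f by (auto simp: simple_graph_def)
    ultimately have "a \<in> R" "b \<in> R"
      using trace[of a] trace[of b] a \<open>b \<in> V\<close> e f by auto
    then have "3 \<le> graph_dist E a b"
      using far \<open>a \<noteq> b\<close> by blast
    moreover have "graph_dist E a b \<le> 2"
      using ef e f by (intro graph_dist_common_neighbour[of _ x]) (auto simp: insert_commute)
    ultimately show False
      by simp
  qed
  then show ?thesis
    unfolding edge_resolving_def by blast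
qed

lemma edim_le_card: "edge_resolving V E S \<Longrightarrow> edim V E \<le> card S"
  unfolding edim_def by (rule Least_le) blast

text \<open>A shortest walk is shortest between any two of its vertices: a shortcut between them would
  shorten the whole walk.\<close>

lemma geodesic:
  assumes "(u, v) \<in> (adj_rel E)\<^sup>*"
  obtains p where "p 0 = u" "\<And>i. i < graph_dist E u v \<Longrightarrow> {p i, p (Suc i)} \<in> E"
    "\<And>i j. i \<le> j \<Longrightarrow> j \<le> graph_dist E u v \<Longrightarrow> graph_dist E (p i) (p j) = j - i"
proof -
  let ?D = "graph_dist E u v" and ?A = "adj_rel E"
  obtain p where p: "p 0 = u" "p ?D = v" "\<And>i. i < ?D \<Longrightarrow> (p i, p (Suc i)) \<in> ?A"
    using shortest_walk[OF assms] unfolding relpow_fun_conv by blast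
  have walk: "(p i, p j) \<in> ?A ^^ (j - i)" if "i \<le> j" "j \<le> ?D" for i j
    unfolding relpow_fun_conv using that p(3) by (intro exI[of _ "\<lambda>l. p (i + l)"]) auto
  have "graph_dist E (p i) (p j) = j - i" if ij: "i \<le> j" "j \<le> ?D" for i j
  proof (rule antisym)
    show "graph_dist E (p i) (p j) \<le> j - i"
      using walk[OF ij] by (rule graph_dist_le)
    have short: "(p i, p j) \<in> ?A ^^ graph_dist E (p i) (p j)"
      using walk[OF ij] by (intro shortest_walk) (auto simp: rtrancl_power)
    have "(u, p i) \<in> ?A ^^ i" "(p j, v) \<in> ?A ^^ (?D - j)"
      using walk[of 0 i] walk[of j ?D] p ij by auto
    with short have "(u, v) \<in> ?A ^^ (i + graph_dist E (p i) (p j) + (?D - j))"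
      by (auto simp: relpow_add)
    then show "j - i \<le> graph_dist E (p i) (p j)"
      using graph_dist_le[of u v _ E] ij by fastforce
  qed
  with p show thesis
    by (intro that[of p]) (auto simp: adj_rel_def)
qed

lemma diameter_attained:
  assumes "finite V" "V \<noteq> {}"
  obtains u v where "u \<in> V" "v \<in> V" "graph_dist E u v = diameter V E"
proof -
  let ?S = "{graph_dist E u v | u v. u \<in> V \<and> v \<in> V}"
  have "?S = (\<lambda>(u, v). graph_dist E u v) ` (V \<times> V)"
    by auto
  then have "Max ?S \<in> ?S"
    using assms by (intro Max_in) auto
  then show thesis
    using that unfolding diameter_def by auto
qed

theorem edim_add_diameter_div_3_less:
  assumes G: "simple_graph V E" "connected_graph V E"
  shows "edim V E + diameter V E div 3 < card V"
proof -
  let ?D = "diameter V E"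
  have V: "finite V" "V \<noteq> {}"
    using G by (auto simp: simple_graph_def connected_graph_def)
  obtain u v where uv: "u \<in> V" "v \<in> V" "graph_dist E u v = ?D"
    using diameter_attained[OF V] .
  have "(u, v) \<in> (adj_rel E)\<^sup>*"
    using G(2) uv by (auto simp: connected_graph_def)
  then obtain p where p: "p 0 = u" "\<And>i. i < ?D \<Longrightarrow> {p i, p (Suc i)} \<in> E"
    and dist: "\<And>i j. i \<le> j \<Longrightarrow> j \<le> ?D \<Longrightarrow> graph_dist E (p i) (p j) = j - i"
    by (rule geodesic) (auto simp: uv(3))
  have pV: "p i \<in> V" if "i \<le> ?D" for i
  proof (cases i)
    case 0
    then show ?thesis using p(1) uv(1) by simp
  next
    case (Suc j)
    then show ?thesis using p(2)[of j] that G(1) by (auto simp: simple_graph_def)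
  qed
  define q where "q i = p (3 * i)" for i
  let ?I = "{..?D div 3}"
  have q_dist: "3 \<le> graph_dist E (q i) (q j)" if "i \<in> ?I" "j \<in> ?I" "i < j" for i j
    using that dist[of "3 * i" "3 * j"] by (auto simp: q_def)
  have far: "3 \<le> graph_dist E (q i) (q j)" if "i \<in> ?I" "j \<in> ?I" "i \<noteq> j" for i j
    using q_dist[of i j] q_dist[of j i] that graph_dist_commute[of E "q i"]
    by (cases i j rule: linorder_cases) auto
  have "inj_on q ?I"
  proof (rule inj_onI, rule ccontr)
    fix i j assume "i \<in> ?I" "j \<in> ?I" "q i = q j" "i \<noteq> j"
    then show False using far[of i j] by simp
  qed
  then have card_R: "card (q ` ?I) = Suc (?D div 3)"
    by (simp add: card_image)
  have R: "q ` ?I \<subseteq> V"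
    using pV by (auto simp: q_def)
  have "edge_resolving V E (V - q ` ?I)"
    using far by (intro edge_resolving_Diff_packing[OF G]) auto
  then have "edim V E \<le> card V - card (q ` ?I)"
    using edim_le_card R V(1) by (metis card_Diff_subset finite_subset)
  moreover have "card (q ` ?I) \<le> card V"
    using R V(1) by (rule card_mono[rotated])
  ultimately show ?thesis
    using card_R by linarith
qed

theorem theorem4p6:
  fixes V :: "'a set" and E :: "'a set set" and n k :: nat
  assumes "k > 0"
    and "simple_graph V E"
    and "connected_graph V E"
    and "card V = n"
    and "int (edim V E) = int n - int k"
  shows "diameter V E \<le> 3 * k - 1"
proof -
  have "diameter V E div 3 < k"
    using edim_add_diameter_div_3_less[OF assms(2,3)] assms(4,5) by linarith
  then show ?thesis
    by linarith
qed

end
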